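(* Let $X$ and $Y$ be prebornological spaces and let $f\colon X\to Y$ be a map. (1) If $f$ is bornological, then ${}^{\ast}f\left(\mathrm{FIN}(X)\right)\subseteq\mathrm{FIN}(Y)$. If $Y$ is connected, the converse is also true. (2) If $f$ is bornological, then $({}^{\ast}f)^{-1}\left(\mathrm{INF}(Y)\right)\subseteq\mathrm{INF}(X)$. If $Y$ is connected, the converse is also true. (3) If $f$ is proper, then $({}^{\ast}f)^{-1}\left(\mathrm{FIN}(Y)\right)\subseteq\mathrm{FIN}(X)$. If $X$ is connected, the converse is also true. (4) If $f$ is proper, then ${}^{\ast}f\left(\mathrm{INF}(X)\right)\subseteq\mathrm{INF}(Y)$. If $X$ is connected, the converse is also true.
   Context: Nonstandard setting: fix a transitive universe $\mathbb{U}$ (the standard universe) satisfying sufficiently many axioms of ZFC and containing all standard objects considered, and a $|\mathbb{U}|^{+}$-saturated enlargement $\ast\colon\mathbb{U}\hookrightarrow{}^{\ast}\mathbb{U}$ (so transfer, i.e. elementary extension, and saturation are available). A standard set $X$ is regarded as a subset of ${}^{\ast}X$ by identifying $x$ with ${}^{\ast}x$. A prebornology on a set $X$ is a nonempty $\mathcal{B}_{X}\subseteq\mathcal{P}(X)$ such that (i) $\bigcup\mathcal{B}_{X}=X$; (ii) $B\in\mathcal{B}_{X}$ and $C\subseteq B$ imply $C\in\mathcal{B}_{X}$; (iii) $B,C\in\mathcal{B}_{X}$ and $B\cap C\neq\varnothing$ imply $B\cup C\in\mathcal{B}_{X}$. The pair $(X,\mathcal{B}_{X})$ is a prebornological space;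 elements of $\mathcal{B}_{X}$ are called bounded sets. It is connected if every finite subset of $X$ is bounded. For $x\in X$, $\mathcal{BN}_{X}(x)=\{B\in\mathcal{B}_{X}: x\in B\}$, and the galaxy of $x$ is $G_{X}(x)=\bigcup_{B\in\mathcal{BN}_{X}(x)}{}^{\ast}B\subseteq{}^{\ast}X$. A point of ${}^{\ast}X$ is finite if it belongs to $G_{X}(x')$ for some $x'\in X$, and infinite otherwise; $\mathrm{FIN}(X)$ and $\mathrm{INF}(X)$ denote the sets of finite and infinite points of ${}^{\ast}X$. A map $f\colon X\to Y$ between prebornological spaces is bornological if for every $x\in X$ and every $B\in\mathcal{BN}_{X}(x)$ one has $f(B)\in\mathcal{BN}_{Y}(f(x))$. It is proper if $f^{-1}(B)\in\mathcal{B}_{X}$ for every $B\in\mathcal{B}_{Y}$. *)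

theory Defs
  imports Main "HOL-Library.Equipollence"
begin

section \<open>Prebornological spaces\<close>

definition prebornology :: "'a set \<Rightarrow> 'a set set \<Rightarrow> bool" where
  "prebornology X \<B> \<longleftrightarrow>
     \<B> \<noteq> {} \<and> \<B> \<subseteq> Pow X \<and> \<Union>\<B> = X \<and>
     (\<forall>B C. B \<in> \<B> \<longrightarrow> C \<subseteq> B \<longrightarrow> C \<in> \<B>) \<and>
     (\<forall>B C. B \<in> \<B> \<longrightarrow> C \<in> \<B> \<longrightarrow> B \<inter> C \<noteq> {} \<longrightarrow> B \<union> C \<in> \<B>)"

definition connected_prebornology :: "'a set \<Rightarrow> 'a set set \<Rightarrow> bool" where
  "connected_prebornology X \<B> \<longleftrightarrow> (\<forall>F. F \<subseteq> X \<longrightarrow> finite F \<longrightarrow> F \<in> \<B>)"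

definition bounded_nbhds :: "'a set set \<Rightarrow> 'a \<Rightarrow> 'a set set" where
  "bounded_nbhds \<B> x = {B \<in> \<B>. x \<in> B}"

definition bornological_map ::
    "'a set \<Rightarrow> 'a set set \<Rightarrow> 'b set set \<Rightarrow> ('a \<Rightarrow> 'b) \<Rightarrow> bool" where
  "bornological_map X \<B> \<C> f \<longleftrightarrow>
     (\<forall>x\<in>X. \<forall>B\<in>bounded_nbhds \<B> x. f ` B \<in> bounded_nbhds \<C> (f x))"

definition bornologically_proper ::
    "'a set \<Rightarrow> 'a set set \<Rightarrow> 'b set set \<Rightarrow> ('a \<Rightarrow> 'b) \<Rightarrow> bool" where
  "bornologically_proper X \<B> \<C> f \<longleftrightarrow> (\<forall>B\<in>\<C>. {x \<in> X. f x \<in> B} \<in> \<B>)"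

section \<open>First-order structures for the language of set theory\<close>

text \<open>Variables are de Bruijn indices into an environment.\<close>

datatype set_formula =
    Member nat nat
  | Equal nat nat
  | Neg set_formula
  | Conj set_formula set_formula
  | Forall set_formula

primrec sat :: "('u \<Rightarrow> 'u \<Rightarrow> bool) \<Rightarrow> set_formula \<Rightarrow> (nat \<Rightarrow> 'u) \<Rightarrow> bool" where
  "sat E (Member i j) e \<longleftrightarrow> E (e i) (e j)"
| "sat E (Equal i j) e \<longleftrightarrow> e i = e j"
| "sat E (Neg \<phi>) e \<longleftrightarrow> \<not> sat E \<phi> e"
| "sat E (Conj \<phi> \<psi>) e \<longleftrightarrow> sat E \<phi> e \<and> sat E \<psi> e"
| "sat E (Forall \<phi>) e \<longleftrightarrow> (\<forall>x. sat E \<phi> (case_nat x e))"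

definition elts :: "('u \<Rightarrow> 'u \<Rightarrow> bool) \<Rightarrow> 'u \<Rightarrow> 'u set" where
  "elts E a = {x. E x a}"

text \<open>
  A transitive universe is given by its membership relation \<open>E\<close> on the type of all its members.
  By Mostowski's theorem the structures isomorphic to a transitive set with the true membership
  relation are exactly the well-founded extensional ones.  The axioms of ZFC required are those of
  Zermelo set theory with choice (foundation is part of well-foundedness); replacement is not
  assumed, so that every \<open>V\<^sub>\<lambda>\<close> with \<open>\<lambda> > \<omega>\<close> a limit ordinal qualifies.  The power set is the one
  relative to the universe.
\<close>

definition standard_universe :: "('u \<Rightarrow> 'u \<Rightarrow> bool) \<Rightarrow> bool" where
  "standard_universe E \<longleftrightarrow>
     wfP E \<and>
     \<comment> \<open>extensionality\<close>
     (\<forall>a b. elts E a = elts E b \<longrightarrow> a = b) \<and>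
     \<comment> \<open>pairing\<close>
     (\<forall>a b. \<exists>c. elts E c = {a, b}) \<and>
     \<comment> \<open>union\<close>
     (\<forall>a. \<exists>c. elts E c = (\<Union>b\<in>elts E a. elts E b)) \<and>
     \<comment> \<open>power set\<close>
     (\<forall>a. \<exists>c. elts E c = {b. elts E b \<subseteq> elts E a}) \<and>
     \<comment> \<open>separation, with parameters\<close>
     (\<forall>\<phi> e a. \<exists>c. elts E c = {x \<in> elts E a. sat E \<phi> (case_nat x e)}) \<and>
     \<comment> \<open>infinity\<close>
     (\<exists>w. (\<exists>z\<in>elts E w. elts E z = {}) \<and>
          (\<forall>x\<in>elts E w. \<exists>y\<in>elts E w. elts E y = insert x (elts E x))) \<and>
     \<comment> \<open>choice\<close>
     (\<forall>a. (\<forall>x\<in>elts E a. elts E x \<noteq> {}) \<longrightarrow>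
          (\<forall>x\<in>elts E a. \<forall>y\<in>elts E a. x \<noteq> y \<longrightarrow> elts E x \<inter> elts E y = {}) \<longrightarrow>
          (\<exists>c. \<forall>x\<in>elts E a. \<exists>!z. z \<in> elts E c \<and> z \<in> elts E x))"

definition elementary_embedding ::
    "('u \<Rightarrow> 'u \<Rightarrow> bool) \<Rightarrow> ('v \<Rightarrow> 'v \<Rightarrow> bool) \<Rightarrow> ('u \<Rightarrow> 'v) \<Rightarrow> bool" where
  "elementary_embedding E E' star \<longleftrightarrow>
     (\<forall>\<phi> e. sat E \<phi> e \<longleftrightarrow> sat E' \<phi> (\<lambda>i. star (e i)))"

text \<open>
  \<open>|K|\<^sup>+\<close>-saturation: every family of fewer than \<open>|K|\<^sup>+\<close>, i.e. at most \<open>|K|\<close>, internal sets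
  (members of the structure) with the finite intersection property has a common element.
\<close>

definition succ_card_saturated :: "'k set \<Rightarrow> ('v \<Rightarrow> 'v \<Rightarrow> bool) \<Rightarrow> bool" where
  "succ_card_saturated K E \<longleftrightarrow>
     (\<forall>\<A>. \<A> \<lesssim> K \<longrightarrow>
        (\<forall>\<F>. \<F> \<subseteq> \<A> \<longrightarrow> finite \<F> \<longrightarrow> (\<exists>x. \<forall>A\<in>\<F>. x \<in> elts E A)) \<longrightarrow>
        (\<exists>x. \<forall>A\<in>\<A>. x \<in> elts E A))"

definition saturated_enlargement ::
    "('u \<Rightarrow> 'u \<Rightarrow> bool) \<Rightarrow> ('v \<Rightarrow> 'v \<Rightarrow> bool) \<Rightarrow> ('u \<Rightarrow> 'v) \<Rightarrow> bool" where
  "saturated_enlargement E E' star \<longleftrightarrow>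
     elementary_embedding E E' star \<and> succ_card_saturated (UNIV :: 'u set) E'"

section \<open>Maps and families of sets as members of a structure\<close>

definition is_opair :: "('u \<Rightarrow> 'u \<Rightarrow> bool) \<Rightarrow> 'u \<Rightarrow> 'u \<Rightarrow> 'u \<Rightarrow> bool" where
  "is_opair E p x y \<longleftrightarrow>
     (\<exists>a b. elts E a = {x} \<and> elts E b = {x, y} \<and> elts E p = {a, b})"

definition is_map :: "('u \<Rightarrow> 'u \<Rightarrow> bool) \<Rightarrow> 'u \<Rightarrow> 'u \<Rightarrow> 'u \<Rightarrow> bool" where
  "is_map E f X Y \<longleftrightarrow>
     (\<forall>p\<in>elts E f. \<exists>x\<in>elts E X. \<exists>y\<in>elts E Y. is_opair E p x y) \<and>
     (\<forall>x\<in>elts E X. \<exists>!y. \<exists>p\<in>elts E f. is_opair E p x y)"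

definition app :: "('u \<Rightarrow> 'u \<Rightarrow> bool) \<Rightarrow> 'u \<Rightarrow> 'u \<Rightarrow> 'u" where
  "app E f x = (THE y. \<exists>p\<in>elts E f. is_opair E p x y)"

definition sets_of :: "('u \<Rightarrow> 'u \<Rightarrow> bool) \<Rightarrow> 'u \<Rightarrow> 'u set set" where
  "sets_of E \<B> = elts E ` elts E \<B>"

section \<open>Galaxies, finite and infinite points\<close>

text \<open>
  Only standard bounded sets \<open>B\<close> contribute to a galaxy: the union ranges over the members \<open>B\<close> of
  \<open>\<B>\<close> in the standard universe, not over the internal members of \<open>star \<B>\<close>.
\<close>

definition galaxy ::
    "('u \<Rightarrow> 'u \<Rightarrow> bool) \<Rightarrow> ('v \<Rightarrow> 'v \<Rightarrow> bool) \<Rightarrow> ('u \<Rightarrow> 'v) \<Rightarrow> 'u \<Rightarrow> 'u \<Rightarrow> 'v set" where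
  "galaxy E E' star \<B> x = (\<Union>B\<in>{B \<in> elts E \<B>. x \<in> elts E B}. elts E' (star B))"

definition FIN_points ::
    "('u \<Rightarrow> 'u \<Rightarrow> bool) \<Rightarrow> ('v \<Rightarrow> 'v \<Rightarrow> bool) \<Rightarrow> ('u \<Rightarrow> 'v) \<Rightarrow> 'u \<Rightarrow> 'u \<Rightarrow> 'v set" where
  "FIN_points E E' star X \<B> =
     {\<xi> \<in> elts E' (star X). \<exists>x\<in>elts E X. \<xi> \<in> galaxy E E' star \<B> x}"

definition INF_points ::
    "('u \<Rightarrow> 'u \<Rightarrow> bool) \<Rightarrow> ('v \<Rightarrow> 'v \<Rightarrow> bool) \<Rightarrow> ('u \<Rightarrow> 'v) \<Rightarrow> 'u \<Rightarrow> 'u \<Rightarrow> 'v set" where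
  "INF_points E E' star X \<B> = elts E' (star X) - FIN_points E E' star X \<B>"

definition star_image ::
    "('v \<Rightarrow> 'v \<Rightarrow> bool) \<Rightarrow> ('u \<Rightarrow> 'v) \<Rightarrow> 'u \<Rightarrow> 'v set \<Rightarrow> 'v set" where
  "star_image E' star f S = app E' (star f) ` S"

definition star_preimage ::
    "('v \<Rightarrow> 'v \<Rightarrow> bool) \<Rightarrow> ('u \<Rightarrow> 'v) \<Rightarrow> 'u \<Rightarrow> 'u \<Rightarrow> 'v set \<Rightarrow> 'v set" where
  "star_preimage E' star X f S = {\<xi> \<in> elts E' (star X). app E' (star f) \<xi> \<in> S}"

end

theory Submission
  imports Defs
begin

text \<open>
  The proof rests on three observations, all about a standard set \<open>a\<close> and its extension
  \<open>\<^sup>*a\<close>, the set of points that lie in \<open>star a\<close>.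

  Transfer: a subset of a standard set that is cut out by a formula with standard parameters is
  itself standard, by separation, and its extension is cut out by the same formula in the enlarged
  universe (\<open>standard_comprehension\<close>).  Hence extension commutes with differences and with images
  and preimages under \<open>f\<close>: \<open>\<^sup>*(f(B)) = \<^sup>*f(\<^sup>*B)\<close> and \<open>\<^sup>*(f\<^sup>-\<^sup>1(C)) = (\<^sup>*f)\<^sup>-\<^sup>1(\<^sup>*C)\<close>.

  Finite points: since the extension of the empty set is empty, the base point of a galaxy can be
  forgotten, and the finite points of \<open>X\<close> are the union of all \<open>\<^sup>*B\<close> with \<open>B\<close> bounded
  (\<open>FIN_points_eq\<close>).  So if \<open>f\<close> takes bounded sets to bounded sets, then \<open>\<^sup>*f\<close> takes finite points
  to finite points, and dually for preimages.

  Saturation: if \<open>\<^sup>*S\<close> is covered by sets \<open>\<^sup>*C\<close>, then \<open>S\<close> is covered by finitely many of the \<open>C\<close>,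
  for otherwise the sets \<open>\<^sup>*(S - C)\<close> have the finite intersection property and a common point would
  escape the cover (\<open>finite_subcover\<close>).  In a connected prebornological space finite unions of
  bounded sets are bounded, so there a standard set is bounded as soon as its extension consists of
  finite points (\<open>bounded_if_ext_finite\<close>).  Applied to \<open>f(B)\<close> and to \<open>f\<^sup>-\<^sup>1(C)\<close>, this gives the two
  converses for finite points.

  The parts about infinite points are the contrapositives of those about finite points, because
  \<open>\<^sup>*f\<close> maps \<open>\<^sup>*X\<close> into \<open>\<^sup>*Y\<close> and the infinite points are the complement of the finite ones.
\<close>

section \<open>Formulas and renaming of variables\<close>

definition Exists :: "set_formula \<Rightarrow> set_formula" where
  "Exists \<phi> = Neg (Forall (Neg \<phi>))"

definition Disj :: "set_formula \<Rightarrow> set_formula \<Rightarrow> set_formula" where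
  "Disj \<phi> \<psi> = Neg (Conj (Neg \<phi>) (Neg \<psi>))"

definition Impl :: "set_formula \<Rightarrow> set_formula \<Rightarrow> set_formula" where
  "Impl \<phi> \<psi> = Neg (Conj \<phi> (Neg \<psi>))"

definition Iff :: "set_formula \<Rightarrow> set_formula \<Rightarrow> set_formula" where
  "Iff \<phi> \<psi> = Conj (Impl \<phi> \<psi>) (Impl \<psi> \<phi>)"

lemma sat_connectives [simp]:
  "sat E (Exists \<phi>) e \<longleftrightarrow> (\<exists>x. sat E \<phi> (case_nat x e))"
  "sat E (Disj \<phi> \<psi>) e \<longleftrightarrow> sat E \<phi> e \<or> sat E \<psi> e"
  "sat E (Impl \<phi> \<psi>) e \<longleftrightarrow> (sat E \<phi> e \<longrightarrow> sat E \<psi> e)"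
  "sat E (Iff \<phi> \<psi>) e \<longleftrightarrow> (sat E \<phi> e \<longleftrightarrow> sat E \<psi> e)"
  by (auto simp: Exists_def Disj_def Impl_def Iff_def)

primrec rename :: "(nat \<Rightarrow> nat) \<Rightarrow> set_formula \<Rightarrow> set_formula" where
  "rename r (Member i j) = Member (r i) (r j)"
| "rename r (Equal i j) = Equal (r i) (r j)"
| "rename r (Neg \<phi>) = Neg (rename r \<phi>)"
| "rename r (Conj \<phi> \<psi>) = Conj (rename r \<phi>) (rename r \<psi>)"
| "rename r (Forall \<phi>) = Forall (rename (case_nat 0 (\<lambda>i. Suc (r i))) \<phi>)"

lemma sat_rename: "sat E (rename r \<phi>) e \<longleftrightarrow> sat E \<phi> (\<lambda>i. e (r i))"
proof (induction \<phi> arbitrary: r e)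
  case (Forall \<phi>)
  have "(\<lambda>i. case_nat x e (case_nat 0 (\<lambda>i. Suc (r i)) i)) = case_nat x (\<lambda>i. e (r i))" for x
    by (auto split: nat.split)
  then show ?case by (simp add: Forall.IH)
qed auto

lemma map_case_nat: "(\<lambda>i. h (case_nat a e i)) = case_nat (h a) (\<lambda>i. h (e i))"
  by (auto split: nat.split)

text \<open>
  Kuratowski's pair.  Innermost, index \<open>1\<close> denotes \<open>{x, y}\<close>, index \<open>2\<close> denotes \<open>{x}\<close>, and the
  free variables are shifted by the three binders.
\<close>

definition opair_fm :: "nat \<Rightarrow> nat \<Rightarrow> nat \<Rightarrow> set_formula" where
  "opair_fm p x y =
     Exists (Exists (Conj (Forall (Iff (Member 0 2) (Equal 0 (Suc (Suc (Suc x))))))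
       (Conj
         (Forall (Iff (Member 0 1)
           (Disj (Equal 0 (Suc (Suc (Suc x)))) (Equal 0 (Suc (Suc (Suc y)))))))
         (Forall (Iff (Member 0 (Suc (Suc (Suc p)))) (Disj (Equal 0 2) (Equal 0 1)))))))"

lemma sat_opair_fm: "sat E (opair_fm p x y) e \<longleftrightarrow> is_opair E (e p) (e x) (e y)"
  by (simp add: opair_fm_def is_opair_def elts_def set_eq_iff numeral_2_eq_2)

definition graph :: "('u \<Rightarrow> 'u \<Rightarrow> bool) \<Rightarrow> 'u \<Rightarrow> 'u \<Rightarrow> 'u \<Rightarrow> bool" where
  "graph E f x y \<longleftrightarrow> (\<exists>p\<in>elts E f. is_opair E p x y)"

definition graph_fm :: "nat \<Rightarrow> nat \<Rightarrow> nat \<Rightarrow> set_formula" where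
  "graph_fm f x y = Exists (Conj (Member 0 (Suc f)) (opair_fm 0 (Suc x) (Suc y)))"

lemma sat_graph_fm: "sat E (graph_fm f x y) e \<longleftrightarrow> graph E (e f) (e x) (e y)"
  by (auto simp: graph_fm_def graph_def sat_opair_fm elts_def)

section \<open>Maps inside a structure\<close>

text \<open>
  Comparing the extents of the members of \<open>p\<close> reduces injectivity of pairs inside the structure to
  that of the pairs \<open>{{x}, {x, y}}\<close> of actual sets.
\<close>

lemma is_opair_extents:
  assumes "is_opair E p x y"
  shows "elts E ` elts E p = {{x}, {x, y}}"
proof -
  obtain a b where "elts E a = {x}" "elts E b = {x, y}" "elts E p = {a, b}"
    using assms unfolding is_opair_def by blast
  then show ?thesis by simp
qed

lemma is_opair_inject:
  assumes "is_opair E p x y" and "is_opair E p x' y'"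
  shows "x = x' \<and> y = y'"
proof -
  have "{{x}, {x, y}} = {{x'}, {x', y'}}"
    using assms[THEN is_opair_extents] by simp
  then show ?thesis by (auto simp: doubleton_eq_iff)
qed

text \<open>
  Being a map is used only in the following form, which is a first-order property of \<open>f\<close>, \<open>X\<close>, \<open>Y\<close>
  with few quantifiers and so is easy to transfer, and which determines \<open>app\<close>.
\<close>

definition functional :: "('u \<Rightarrow> 'u \<Rightarrow> bool) \<Rightarrow> 'u \<Rightarrow> 'u \<Rightarrow> 'u \<Rightarrow> bool" where
  "functional E f X Y \<longleftrightarrow> (\<forall>x\<in>elts E X. \<exists>y\<in>elts E Y. \<forall>z. graph E f x z \<longleftrightarrow> z = y)"

lemma is_map_imp_functional:
  assumes "is_map E f X Y"
  shows "functional E f X Y"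
  unfolding functional_def
proof
  fix x assume "x \<in> elts E X"
  then have "\<exists>!y. graph E f x y"
    using assms by (simp add: is_map_def graph_def)
  then obtain y where y: "graph E f x y" "\<And>z. graph E f x z \<Longrightarrow> z = y"
    by (elim ex1E) blast
  from y(1) obtain p where p: "p \<in> elts E f" "is_opair E p x y"
    by (auto simp: graph_def)
  obtain x' y' where "y' \<in> elts E Y" "is_opair E p x' y'"
    using assms p(1) unfolding is_map_def by blast
  then have "y \<in> elts E Y"
    using is_opair_inject[OF p(2)] by blast
  then show "\<exists>y\<in>elts E Y. \<forall>z. graph E f x z \<longleftrightarrow> z = y"
    using y by blast
qed

lemma functional_app:
  assumes "functional E f X Y" and "x \<in> elts E X"
  shows "graph E f x z \<longleftrightarrow> z = app E f x" and "app E f x \<in> elts E Y"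
proof -
  obtain y where y: "y \<in> elts E Y" "\<And>z. graph E f x z \<longleftrightarrow> z = y"
    using assms unfolding functional_def by blast
  have "app E f x = y"
    using y(2) by (simp add: app_def graph_def[symmetric])
  then show "graph E f x z \<longleftrightarrow> z = app E f x" "app E f x \<in> elts E Y"
    using y by auto
qed

section \<open>Transfer and saturation\<close>

locale enlargement =
  fixes E :: "'u \<Rightarrow> 'u \<Rightarrow> bool" and E' :: "'v \<Rightarrow> 'v \<Rightarrow> bool" and star :: "'u \<Rightarrow> 'v"
  assumes universe: "standard_universe E"
    and enlargement: "saturated_enlargement E E' star"
begin

abbreviation ext :: "'u \<Rightarrow> 'v set" where
  "ext a \<equiv> elts E' (star a)"

lemma transfer: "sat E \<phi> e \<longleftrightarrow> sat E' \<phi> (\<lambda>i. star (e i))"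
  using enlargement unfolding saturated_enlargement_def elementary_embedding_def by blast

lemma extensionality: "elts E a = elts E b \<Longrightarrow> a = b"
  using universe[unfolded standard_universe_def, THEN conjunct2, THEN conjunct1] by simp

lemma separation: "\<exists>c. elts E c = {x \<in> elts E a. sat E \<phi> (case_nat x e)}"
  using universe[unfolded standard_universe_def, THEN conjunct2, THEN conjunct2, THEN conjunct2,
      THEN conjunct2, THEN conjunct2, THEN conjunct1]
  by (elim allE)

lemma saturation:
  assumes "\<A> \<lesssim> (UNIV :: 'u set)"
    and "\<And>\<F>. \<F> \<subseteq> \<A> \<Longrightarrow> finite \<F> \<Longrightarrow> \<exists>x. \<forall>A\<in>\<F>. x \<in> elts E' A"
  shows "\<exists>x. \<forall>A\<in>\<A>. x \<in> elts E' A"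
  using enlargement[unfolded saturated_enlargement_def succ_card_saturated_def, THEN conjunct2]
    assms by simp

lemma star_in_ext: "x \<in> elts E a \<Longrightarrow> star x \<in> ext a"
  using transfer[of "Member 0 1" "case_nat x (\<lambda>_. a)"] by (simp add: elts_def)

text \<open>
  Separation provides the set, and the sentence saying that the set is the one separated is then
  transferred.  In that sentence the parameters of \<open>\<phi>\<close> are preceded by the set itself and by \<open>a\<close>,
  which is why \<open>\<phi>\<close> has to be renamed.
\<close>

lemma standard_comprehension:
  obtains c where "elts E c = {x \<in> elts E a. sat E \<phi> (case_nat x e)}"
    and "ext c = {x \<in> ext a. sat E' \<phi> (case_nat x (\<lambda>i. star (e i)))}"
proof -
  obtain c where c: "elts E c = {x \<in> elts E a. sat E \<phi> (case_nat x e)}"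
    using separation by blast
  define r :: "nat \<Rightarrow> nat" where "r = case_nat 0 (\<lambda>i. Suc (Suc (Suc i)))"
  define \<psi> where "\<psi> = Forall (Iff (Member 0 1) (Conj (Member 0 2) (rename r \<phi>)))"
  have r: "(\<lambda>i. case_nat x (case_nat c (case_nat a e)) (r i)) = case_nat x e"
    for x c a :: 'w and e
    by (auto simp: r_def split: nat.split)
  have \<psi>: "sat F \<psi> (case_nat c (case_nat a e)) \<longleftrightarrow>
      elts F c = {x \<in> elts F a. sat F \<phi> (case_nat x e)}"
    for F :: "'w \<Rightarrow> 'w \<Rightarrow> bool" and c a e
    by (auto simp: \<psi>_def sat_rename r elts_def numeral_2_eq_2)
  have "sat E \<psi> (case_nat c (case_nat a e))"
    by (simp only: \<psi> c)
  then have "sat E' \<psi> (case_nat (star c) (case_nat (star a) (\<lambda>i. star (e i))))"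
    using transfer[of \<psi> "case_nat c (case_nat a e)"] by (simp only: map_case_nat)
  then have "ext c = {x \<in> ext a. sat E' \<phi> (case_nat x (\<lambda>i. star (e i)))}"
    by (simp only: \<psi>)
  with c show thesis
    by (rule that)
qed

lemma obtain_difference:
  obtains D where "elts E D = elts E S - elts E C" and "ext D = ext S - ext C"
proof -
  have \<phi>: "{x \<in> A. sat F (Neg (Member 0 1)) (case_nat x (\<lambda>_. b))} = A - elts F b"
    for F :: "'w \<Rightarrow> 'w \<Rightarrow> bool" and A b
    by (simp add: elts_def set_diff_eq)
  obtain D where "elts E D = elts E S - elts E C" "ext D = ext S - ext C"
    by (rule standard_comprehension[of S "Neg (Member 0 1)" "\<lambda>_. C", unfolded \<phi>])
  then show thesis by (rule that)
qed

lemma ext_empty: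
  assumes "elts E D = {}"
  shows "ext D = {}"
proof -
  obtain D' where "elts E D' = elts E D - elts E D" "ext D' = ext D - ext D"
    by (rule obtain_difference)
  then show ?thesis using assms extensionality[of D' D] by simp
qed

lemma ext_mono:
  assumes "elts E B \<subseteq> elts E X"
  shows "ext B \<subseteq> ext X"
proof -
  obtain D where "elts E D = elts E B - elts E X" "ext D = ext B - ext X"
    by (rule obtain_difference)
  then show ?thesis using assms ext_empty[of D] by auto
qed

lemma functional_star:
  assumes "functional E f X Y"
  shows "functional E' (star f) (star X) (star Y)"
proof -
  \<comment> \<open>Under the three quantifiers \<open>z, y, x, X, Y, f\<close> have the indices \<open>0\<close> to \<open>5\<close>.\<close>
  define \<psi> where "\<psi> = Forall (Impl (Member 0 1)
     (Exists (Conj (Member 0 3) (Forall (Iff (graph_fm 5 2 0) (Equal 0 1))))))"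
  have \<psi>: "sat F \<psi> (case_nat X (case_nat Y (\<lambda>_. f))) \<longleftrightarrow> functional F f X Y"
    for F :: "'w \<Rightarrow> 'w \<Rightarrow> bool" and X Y f
    by (simp add: \<psi>_def functional_def elts_def sat_graph_fm eval_nat_numeral Ball_def Bex_def)
  have "sat E \<psi> (case_nat X (case_nat Y (\<lambda>_. f)))"
    using assms by (simp only: \<psi>)
  then have "sat E' \<psi> (case_nat (star X) (case_nat (star Y) (\<lambda>_. star f)))"
    using transfer[of \<psi> "case_nat X (case_nat Y (\<lambda>_. f))"] by (simp only: map_case_nat)
  then show ?thesis
    by (simp only: \<psi>)
qed

text \<open>
  Compactness.  The finite intersection property of the sets \<open>\<^sup>*(S - C)\<close> is witnessed by standard
  points, and saturation applies because each of these sets is named by a member of the standard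
  universe.
\<close>

lemma finite_subcover:
  assumes cover: "ext S \<subseteq> (\<Union>C\<in>\<C>. ext C)"
  shows "\<exists>\<F>. finite \<F> \<and> \<F> \<subseteq> \<C> \<and> elts E S \<subseteq> (\<Union>C\<in>\<F>. elts E C)"
proof (rule ccontr)
  assume no_subcover: "\<not> ?thesis"
  have uncovered: "\<not> elts E S \<subseteq> (\<Union>C\<in>\<F>. elts E C)" if "finite \<F>" "\<F> \<subseteq> \<C>" for \<F>
    using that no_subcover by auto
  have "\<exists>D. elts E D = elts E S - elts E C \<and> ext D = ext S - ext C" for C
    by (rule obtain_difference[of S C]) (intro exI conjI)
  then obtain d where d: "\<And>C. elts E (d C) = elts E S - elts E C" "\<And>C. ext (d C) = ext S - ext C"
    by metis
  \<comment> \<open>\<open>S\<close> itself is included so that a common point lies in \<open>\<^sup>*S\<close> even if \<open>\<C>\<close> is empty.\<close>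
  define \<A> where "\<A> = star ` insert S (d ` \<C>)"
  have "\<A> \<lesssim> (UNIV :: 'u set)"
    unfolding \<A>_def by (rule lepoll_trans[OF image_lepoll subset_imp_lepoll]) simp
  moreover have "\<exists>x. \<forall>A\<in>\<G>. x \<in> elts E' A" if \<G>: "\<G> \<subseteq> \<A>" "finite \<G>" for \<G>
  proof -
    have "\<G> - {star S} \<subseteq> (\<lambda>C. star (d C)) ` \<C>"
      using \<G>(1) by (auto simp: \<A>_def)
    then obtain \<F> where \<F>: "finite \<F>" "\<F> \<subseteq> \<C>" "\<G> - {star S} = (\<lambda>C. star (d C)) ` \<F>"
      using finite_subset_image[of "\<G> - {star S}" "\<lambda>C. star (d C)" \<C>] \<G>(2) by auto
    obtain z where "z \<in> elts E S" "\<forall>C\<in>\<F>. z \<notin> elts E C"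
      using uncovered[OF \<F>(1,2)] by blast
    then have "star z \<in> ext S" "\<forall>C\<in>\<F>. star z \<in> ext (d C)"
      using star_in_ext d(1) by auto
    moreover have "\<G> \<subseteq> insert (star S) ((\<lambda>C. star (d C)) ` \<F>)"
      using \<F>(3) by blast
    ultimately have "\<forall>A\<in>\<G>. star z \<in> elts E' A"
      by auto
    then show ?thesis ..
  qed
  ultimately obtain \<xi> where "\<forall>A\<in>\<A>. \<xi> \<in> elts E' A"
    using saturation[of \<A>] by auto
  then have "\<xi> \<in> ext S" "\<forall>C\<in>\<C>. \<xi> \<notin> ext C"
    using d(2) by (auto simp: \<A>_def)
  then show False using cover by blast
qed

section \<open>Finite points and boundedness\<close>

text \<open>
  A bounded set whose extension has a point is nonempty, and any of its standard points serves as
  the centre of a galaxy.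
\<close>

lemma FIN_points_eq:
  assumes "prebornology (elts E X) (sets_of E \<B>)"
  shows "FIN_points E E' star X \<B> = (\<Union>B\<in>elts E \<B>. ext B)"
proof
  show "FIN_points E E' star X \<B> \<subseteq> (\<Union>B\<in>elts E \<B>. ext B)"
    by (auto simp: FIN_points_def galaxy_def)
  show "(\<Union>B\<in>elts E \<B>. ext B) \<subseteq> FIN_points E E' star X \<B>"
  proof
    fix \<xi> assume "\<xi> \<in> (\<Union>B\<in>elts E \<B>. ext B)"
    then obtain B where B: "B \<in> elts E \<B>" "\<xi> \<in> ext B" by blast
    have "elts E B \<subseteq> elts E X"
      using assms B(1) by (auto simp: prebornology_def sets_of_def)
    moreover obtain x where "x \<in> elts E B"
      using B(2) ext_empty by blast
    ultimately show "\<xi> \<in> FIN_points E E' star X \<B>"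
      using B ext_mono[of B X] by (auto simp: FIN_points_def galaxy_def)
  qed
qed

lemma bounded_empty:
  assumes "prebornology X \<B>"
  shows "{} \<in> \<B>"
  using assms unfolding prebornology_def by blast

text \<open>
  Two nonempty bounded sets are linked by the pair formed by a point of each, which connectedness
  makes bounded.
\<close>

lemma connected_bounded_Un:
  assumes "prebornology X \<B>" "connected_prebornology X \<B>" "B \<in> \<B>" "C \<in> \<B>"
  shows "B \<union> C \<in> \<B>"
proof (cases "B = {} \<or> C = {}")
  case False
  then obtain x y where xy: "x \<in> B" "y \<in> C" by blast
  have union: "S \<union> T \<in> \<B>" if "S \<in> \<B>" "T \<in> \<B>" "S \<inter> T \<noteq> {}" for S T
    using assms(1) that unfolding prebornology_def by blast
  have "B \<subseteq> X" "C \<subseteq> X"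
    using assms unfolding prebornology_def by blast+
  then have "{x, y} \<in> \<B>"
    using assms(2) xy unfolding connected_prebornology_def by (metis empty_subsetI finite.emptyI
        finite.insertI insert_subset subsetD)
  then have "B \<union> {x, y} \<union> C \<in> \<B>"
    using union assms(3,4) xy by (metis Int_iff UnCI empty_iff insertI1 insert_commute)
  moreover have "B \<union> {x, y} \<union> C = B \<union> C"
    using xy by blast
  ultimately show ?thesis by simp
qed (use assms in auto)

lemma connected_bounded_UN:
  assumes "prebornology X \<B>" "connected_prebornology X \<B>" "finite \<F>" "\<And>B. B \<in> \<F> \<Longrightarrow> h B \<in> \<B>"
  shows "(\<Union>B\<in>\<F>. h B) \<in> \<B>"
  using assms(3,4)
  by (induction \<F>) (auto intro: connected_bounded_Un[OF assms(1,2)] bounded_empty[OF assms(1)])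

lemma bounded_if_ext_finite:
  assumes "prebornology (elts E X) (sets_of E \<B>)" "connected_prebornology (elts E X) (sets_of E \<B>)"
    and "ext S \<subseteq> FIN_points E E' star X \<B>"
  shows "elts E S \<in> sets_of E \<B>"
proof -
  obtain \<F> where \<F>: "finite \<F>" "\<F> \<subseteq> elts E \<B>" "elts E S \<subseteq> (\<Union>C\<in>\<F>. elts E C)"
    using finite_subcover[of S "elts E \<B>"] assms(3) unfolding FIN_points_eq[OF assms(1)] by blast
  then have "(\<Union>C\<in>\<F>. elts E C) \<in> sets_of E \<B>"
    by (intro connected_bounded_UN[OF assms(1,2)]) (auto simp: sets_of_def)
  then show ?thesis
    using assms(1) \<F>(3) unfolding prebornology_def by blast
qed

lemma ext_subset_FIN_points:
  assumes "prebornology (elts E X) (sets_of E \<B>)" "elts E S \<in> sets_of E \<B>"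
  shows "ext S \<subseteq> FIN_points E E' star X \<B>"
proof -
  have "S \<in> elts E \<B>"
    using assms(2) extensionality unfolding sets_of_def by (metis imageE)
  then show ?thesis
    unfolding FIN_points_eq[OF assms(1)] by blast
qed

end

section \<open>Bornological and proper maps\<close>

locale enlargement_map = enlargement E E' star
  for E :: "'u \<Rightarrow> 'u \<Rightarrow> bool" and E' :: "'v \<Rightarrow> 'v \<Rightarrow> bool" and star :: "'u \<Rightarrow> 'v" +
  fixes X \<B>X Y \<B>Y f :: 'u
  assumes X: "prebornology (elts E X) (sets_of E \<B>X)"
    and Y: "prebornology (elts E Y) (sets_of E \<B>Y)"
    and f: "is_map E f X Y"
begin

abbreviation "FIN_X \<equiv> FIN_points E E' star X \<B>X"
abbreviation "FIN_Y \<equiv> FIN_points E E' star Y \<B>Y"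
abbreviation "INF_X \<equiv> INF_points E E' star X \<B>X"
abbreviation "INF_Y \<equiv> INF_points E E' star Y \<B>Y"

lemmas app_standard = functional_app[OF is_map_imp_functional[OF f]]
lemmas app_star = functional_app[OF functional_star[OF is_map_imp_functional[OF f]]]

lemma bounded_subset_X: "B \<in> elts E \<B>X \<Longrightarrow> elts E B \<subseteq> elts E X"
  using X by (auto simp: prebornology_def sets_of_def)

lemma obtain_image:
  assumes "elts E B \<subseteq> elts E X"
  obtains S where "elts E S = app E f ` elts E B" and "ext S = app E' (star f) ` ext B"
proof -
  \<comment> \<open>Under the quantifier, \<open>0\<close> is a point of \<open>b\<close>, \<open>1\<close> its value, \<open>2\<close> is \<open>b\<close> and \<open>3\<close> is \<open>g\<close>.\<close>
  define \<phi> where "\<phi> = Exists (Conj (Member 0 2) (graph_fm 3 0 1))"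
  have \<phi>: "sat F \<phi> (case_nat y (case_nat b (\<lambda>_. g))) \<longleftrightarrow> (\<exists>x\<in>elts F b. graph F g x y)"
    for F :: "'w \<Rightarrow> 'w \<Rightarrow> bool" and y b g
    by (auto simp: \<phi>_def sat_graph_fm elts_def eval_nat_numeral)
  obtain S where S: "elts E S = {y \<in> elts E Y. \<exists>x\<in>elts E B. graph E f x y}"
    "ext S = {y \<in> ext Y. \<exists>x\<in>ext B. graph E' (star f) x y}"
    by (rule standard_comprehension[of Y \<phi> "case_nat B (\<lambda>_. f)"]) (simp add: map_case_nat \<phi>)
  have "elts E S = app E f ` elts E B"
    unfolding S using assms app_standard by fastforce
  moreover have "ext S = app E' (star f) ` ext B"
    unfolding S using ext_mono[OF assms] app_star by fastforce
  ultimately show thesis by (rule that)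
qed

lemma obtain_preimage:
  obtains D where "elts E D = {x \<in> elts E X. app E f x \<in> elts E C}"
    and "ext D = {x \<in> ext X. app E' (star f) x \<in> ext C}"
proof -
  \<comment> \<open>Here the quantifier binds the value, so the last two arguments of the graph are exchanged.\<close>
  define \<phi> where "\<phi> = Exists (Conj (Member 0 2) (graph_fm 3 1 0))"
  have \<phi>: "sat F \<phi> (case_nat x (case_nat c (\<lambda>_. g))) \<longleftrightarrow> (\<exists>y\<in>elts F c. graph F g x y)"
    for F :: "'w \<Rightarrow> 'w \<Rightarrow> bool" and x c g
    by (auto simp: \<phi>_def sat_graph_fm elts_def eval_nat_numeral)
  obtain D where D: "elts E D = {x \<in> elts E X. \<exists>y\<in>elts E C. graph E f x y}"
    "ext D = {x \<in> ext X. \<exists>y\<in>ext C. graph E' (star f) x y}"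
    by (rule standard_comprehension[of X \<phi> "case_nat C (\<lambda>_. f)"]) (simp add: map_case_nat \<phi>)
  have "elts E D = {x \<in> elts E X. app E f x \<in> elts E C}"
    unfolding D using app_standard by auto
  moreover have "ext D = {x \<in> ext X. app E' (star f) x \<in> ext C}"
    unfolding D using app_star by auto
  ultimately show thesis by (rule that)
qed

lemma bornological_imp_FIN:
  assumes "bornological_map (elts E X) (sets_of E \<B>X) (sets_of E \<B>Y) (app E f)"
  shows "star_image E' star f FIN_X \<subseteq> FIN_Y"
proof -
  have "app E' (star f) \<xi> \<in> FIN_Y" if \<xi>: "\<xi> \<in> FIN_X" for \<xi>
  proof -
    obtain x B where B: "x \<in> elts E X" "B \<in> elts E \<B>X" "x \<in> elts E B" "\<xi> \<in> ext B"
      using \<xi> by (auto simp: FIN_points_def galaxy_def)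
    obtain S where S: "elts E S = app E f ` elts E B" "ext S = app E' (star f) ` ext B"
      using obtain_image[OF bounded_subset_X[OF B(2)]] by blast
    have "elts E S \<in> sets_of E \<B>Y"
      using assms B(1-3) unfolding S(1) bornological_map_def bounded_nbhds_def sets_of_def by blast
    then show ?thesis
      using ext_subset_FIN_points[OF Y] S(2) B(4) by blast
  qed
  then show ?thesis by (auto simp: star_image_def)
qed

lemma FIN_imp_bornological:
  assumes "connected_prebornology (elts E Y) (sets_of E \<B>Y)"
    and "star_image E' star f FIN_X \<subseteq> FIN_Y"
  shows "bornological_map (elts E X) (sets_of E \<B>X) (sets_of E \<B>Y) (app E f)"
proof -
  have "app E f ` elts E B \<in> sets_of E \<B>Y" if B: "B \<in> elts E \<B>X" for B
  proof -
    obtain S where S: "elts E S = app E f ` elts E B" "ext S = app E' (star f) ` ext B"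
      using obtain_image[OF bounded_subset_X[OF B]] by blast
    have "ext B \<subseteq> FIN_X"
      using B unfolding FIN_points_eq[OF X] by blast
    then have "ext S \<subseteq> FIN_Y"
      using assms(2) unfolding S(2) star_image_def by blast
    then show ?thesis
      using bounded_if_ext_finite[OF Y assms(1)] S(1) by metis
  qed
  then show ?thesis
    by (auto simp: bornological_map_def bounded_nbhds_def sets_of_def)
qed

lemma proper_imp_FIN:
  assumes "bornologically_proper (elts E X) (sets_of E \<B>X) (sets_of E \<B>Y) (app E f)"
  shows "star_preimage E' star X f FIN_Y \<subseteq> FIN_X"
proof
  fix \<xi> assume "\<xi> \<in> star_preimage E' star X f FIN_Y"
  then obtain C where C: "C \<in> elts E \<B>Y" "\<xi> \<in> ext X" "app E' (star f) \<xi> \<in> ext C"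
    unfolding star_preimage_def FIN_points_eq[OF Y] by blast
  obtain D where D: "elts E D = {x \<in> elts E X. app E f x \<in> elts E C}"
    "ext D = {x \<in> ext X. app E' (star f) x \<in> ext C}"
    by (rule obtain_preimage)
  have "elts E D \<in> sets_of E \<B>X"
    using assms C(1) unfolding D(1) bornologically_proper_def sets_of_def by blast
  then show "\<xi> \<in> FIN_X"
    using ext_subset_FIN_points[OF X] D(2) C by blast
qed

lemma FIN_imp_proper:
  assumes "connected_prebornology (elts E X) (sets_of E \<B>X)"
    and "star_preimage E' star X f FIN_Y \<subseteq> FIN_X"
  shows "bornologically_proper (elts E X) (sets_of E \<B>X) (sets_of E \<B>Y) (app E f)"
proof -
  have "{x \<in> elts E X. app E f x \<in> elts E C} \<in> sets_of E \<B>X" if C: "C \<in> elts E \<B>Y" for C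
  proof -
    obtain D where D: "elts E D = {x \<in> elts E X. app E f x \<in> elts E C}"
      "ext D = {x \<in> ext X. app E' (star f) x \<in> ext C}"
      by (rule obtain_preimage)
    have "ext C \<subseteq> FIN_Y"
      using C unfolding FIN_points_eq[OF Y] by blast
    then have "ext D \<subseteq> FIN_X"
      using assms(2) unfolding D(2) star_preimage_def by blast
    then show ?thesis
      using bounded_if_ext_finite[OF X assms(1)] D(1) by metis
  qed
  then show ?thesis
    by (auto simp: bornologically_proper_def sets_of_def)
qed

lemma FIN_points_subset_ext: "FIN_points E E' star Z \<B> \<subseteq> ext Z"
  by (auto simp: FIN_points_def)

lemma image_FIN_iff_preimage_INF:
  "star_image E' star f FIN_X \<subseteq> FIN_Y \<longleftrightarrow> star_preimage E' star X f INF_Y \<subseteq> INF_X"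
  using app_star(2) FIN_points_subset_ext[of X]
  by (auto simp: star_image_def star_preimage_def INF_points_def)

lemma preimage_FIN_iff_image_INF:
  "star_preimage E' star X f FIN_Y \<subseteq> FIN_X \<longleftrightarrow> star_image E' star f INF_X \<subseteq> INF_Y"
  using app_star(2)
  by (auto simp: star_image_def star_preimage_def INF_points_def)

end

section \<open>Characterisation by finite and infinite points\<close>

theorem theorem2p28:
  fixes E :: "'u \<Rightarrow> 'u \<Rightarrow> bool" and E' :: "'v \<Rightarrow> 'v \<Rightarrow> bool" and star :: "'u \<Rightarrow> 'v"
    and X \<B>X Y \<B>Y f :: 'u
  assumes "standard_universe E"
    and "saturated_enlargement E E' star"
    and "prebornology (elts E X) (sets_of E \<B>X)"
    and "prebornology (elts E Y) (sets_of E \<B>Y)"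
    and "is_map E f X Y"
  shows
    "((bornological_map (elts E X) (sets_of E \<B>X) (sets_of E \<B>Y) (app E f) \<longrightarrow>
        star_image E' star f (FIN_points E E' star X \<B>X) \<subseteq> FIN_points E E' star Y \<B>Y) \<and>
     (connected_prebornology (elts E Y) (sets_of E \<B>Y) \<longrightarrow>
        star_image E' star f (FIN_points E E' star X \<B>X) \<subseteq> FIN_points E E' star Y \<B>Y \<longrightarrow>
        bornological_map (elts E X) (sets_of E \<B>X) (sets_of E \<B>Y) (app E f))) \<and>
     ((bornological_map (elts E X) (sets_of E \<B>X) (sets_of E \<B>Y) (app E f) \<longrightarrow>
        star_preimage E' star X f (INF_points E E' star Y \<B>Y) \<subseteq> INF_points E E' star X \<B>X) \<and>
     (connected_prebornology (elts E Y) (sets_of E \<B>Y) \<longrightarrow>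
        star_preimage E' star X f (INF_points E E' star Y \<B>Y) \<subseteq> INF_points E E' star X \<B>X \<longrightarrow>
        bornological_map (elts E X) (sets_of E \<B>X) (sets_of E \<B>Y) (app E f))) \<and>
     ((bornologically_proper (elts E X) (sets_of E \<B>X) (sets_of E \<B>Y) (app E f) \<longrightarrow>
        star_preimage E' star X f (FIN_points E E' star Y \<B>Y) \<subseteq> FIN_points E E' star X \<B>X) \<and>
     (connected_prebornology (elts E X) (sets_of E \<B>X) \<longrightarrow>
        star_preimage E' star X f (FIN_points E E' star Y \<B>Y) \<subseteq> FIN_points E E' star X \<B>X \<longrightarrow>
        bornologically_proper (elts E X) (sets_of E \<B>X) (sets_of E \<B>Y) (app E f))) \<and>
     ((bornologically_proper (elts E X) (sets_of E \<B>X) (sets_of E \<B>Y) (app E f) \<longrightarrow>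
        star_image E' star f (INF_points E E' star X \<B>X) \<subseteq> INF_points E E' star Y \<B>Y) \<and>
     (connected_prebornology (elts E X) (sets_of E \<B>X) \<longrightarrow>
        star_image E' star f (INF_points E E' star X \<B>X) \<subseteq> INF_points E E' star Y \<B>Y \<longrightarrow>
        bornologically_proper (elts E X) (sets_of E \<B>X) (sets_of E \<B>Y) (app E f)))"
proof -
  interpret enlargement_map E E' star X \<B>X Y \<B>Y f
    using assms by unfold_locales
  show ?thesis
    using bornological_imp_FIN FIN_imp_bornological proper_imp_FIN FIN_imp_proper
      image_FIN_iff_preimage_INF preimage_FIN_iff_image_INF
    by blast
qed

end
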